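(* For every integer $N\geq 2$, every integer $q\geq 1$ and every Dirichlet character $\chi$ modulo $q$, the Dirichlet series $L(s,\chi)+L(2s,\chi)+\cdots+L(Ns,\chi)$ has infinitely many zeros in the half-plane $\sigma>1$.
   Context: Write $s=\sigma+it$ with $\sigma,t\in\mathbb{R}$. $L(s,\chi)=\sum_{n\ge 1}\chi(n)n^{-s}$ is the Dirichlet $L$-function of $\chi$, absolutely convergent for $\sigma>1$ (for $q=1$ it is the Riemann zeta function $\zeta(s)$). *)

theory Defs
  imports "HOL-Analysis.Analysis"
begin

definition dirichlet_character :: "nat \<Rightarrow> (int \<Rightarrow> complex) \<Rightarrow> bool" where
  "dirichlet_character q chi \<longleftrightarrow>
     (\<forall>a b. chi (a * b) = chi a * chi b) \<and>
     (\<forall>a. chi (a + int q) = chi a) \<and>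
     (\<forall>a. chi a \<noteq> 0 \<longleftrightarrow> coprime a (int q))"

(* The series is indexed from 1, and only its values for Re s > 1, where it
   converges absolutely, are meaningful; no analytic continuation is included. *)
definition dirichlet_L :: "(int \<Rightarrow> complex) \<Rightarrow> complex \<Rightarrow> complex" where
  "dirichlet_L chi s = (\<Sum>n. chi (int (Suc n)) * of_nat (Suc n) powr (- s))"

end

theory Submission
  imports Defs "HOL-Complex_Analysis.Complex_Analysis" "HOL-Number_Theory.Number_Theory"
begin

text \<open>
  Write \<open>F s\<close> for the sum of the \<open>L(k s, chi)\<close> with \<open>1 \<le> k \<le> N\<close>. The proof follows Bohr's idea that the
  vertical translates of a Dirichlet series come arbitrarily close to every series obtained from it
  by replacing \<open>n powr (- s)\<close> with \<open>u n * n powr (- s)\<close>, where \<open>u\<close> is completely multiplicative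
  with values on the unit circle and otherwise free at the primes. It therefore suffices to find such a
  twist \<open>F_u\<close> of \<open>F\<close> with a zero just to the right of \<open>Re s = 1\<close>.

  Finding the twist (\<open>exists_twisted_zero\<close>). For \<open>k \<ge> 2\<close> and \<open>\<sigma> > 1\<close> each twisted \<open>L(k \<sigma>, chi)\<close> is within
  \<open>pi\<^sup>2 / 6 - 1 < 1\<close> of 1 whatever \<open>u\<close> is (\<open>twisted_L_near_1\<close>), so their sum \<open>G\<close> lies in a fixed compact
  subset of the right half-plane, and \<open>\<i> pi + Ln G\<close> is a bounded, continuously varying
  logarithm of \<open>- G\<close>. By the Euler product, the logarithm \<open>\<Lambda>\<close> of the remaining term \<open>k = 1\<close> is up to a
  bounded error the sum of the unit numbers \<open>chi p * u p\<close> weighted by \<open>p powr (- \<sigma>)\<close>. The total weight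
  tends to infinity as \<open>\<sigma>\<close> decreases to 1 (\<open>prime_sum_large\<close>), so the weighted sum can be steered
  continuously, again up to a bounded error, to every target \<open>v\<close> of a disc of any prescribed radius (\<open>steering\<close>).
  The map \<open>v \<mapsto> v - \<Lambda> v + \<i> pi + Ln (G v)\<close> then sends a large enough disc into itself. At a Brouwer fixed
  point, \<open>\<Lambda> v\<close> is a logarithm of \<open>- G v\<close>, which is the required zero. The fixed point takes care of all
  bounded errors, and of the dependence of \<open>G\<close> on the twist, at once.

  Passing back to \<open>F\<close>. The logarithms of the primes are linearly independent over the integers, so by
  Kronecker's theorem some translates \<open>F (s + \<i> t m)\<close> tend to \<open>F_u s\<close> locally uniformly. If \<open>F\<close> had only finitely
  many zeros with \<open>Re s > 1\<close>, some strip \<open>1 < Re s < b\<close> would contain none of them. The translates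
  would be zero-free on that strip, and by Hurwitz's theorem so would be every nonconstant limit \<open>F_u\<close>. This contradicts
  the zero of a twist constructed for some \<open>\<sigma> < b\<close>.
\<close>

section \<open>Euler products by sieving\<close>

text \<open>Each step of the sieve works as follows: the numbers that survive the first \<open>m\<close> primes split into those that
  also survive \<open>p m\<close> and the multiples of \<open>p m\<close>, and multiplication by \<open>p m\<close> is a bijection from all
  survivors onto these multiples, which contribute the factor \<open>f (p m)\<close>.\<close>

lemma euler_sieve:
  fixes f :: "nat \<Rightarrow> complex" and p :: "nat \<Rightarrow> nat"
  assumes mult: "\<And>m n. f (m * n) = f m * f n"
    and summ: "f summable_on UNIV"
    and p: "\<And>i. prime (p i)" "inj p"
  shows "(\<Prod>i<m. 1 - f (p i)) * infsum f UNIV = infsum f {n. \<forall>i<m. \<not> p i dvd n}"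
proof (induction m)
  case (Suc m)
  define B where "B k = {n. \<forall>i<k. \<not> p i dvd n}" for k
  have summB: "f summable_on X" for X
    by (rule summable_on_subset_banach[OF summ]) auto
  have inj: "inj_on ((*) (p m)) (B m)"
    using prime_gt_0_nat[OF p(1)[of m]] by (auto simp: inj_on_def)
  have img: "(*) (p m) ` B m = {n \<in> B m. p m dvd n}"
  proof -
    have "p i dvd p m * n \<longleftrightarrow> p i dvd n" if "i < m" for i n
      using that p by (metis injD less_irrefl prime_dvd_mult_iff primes_dvd_imp_eq)
    hence mem: "p m * n \<in> B m \<longleftrightarrow> n \<in> B m" for n
      by (simp add: B_def)
    show ?thesis
    proof (rule subset_antisym; rule subsetI)
      fix n assume "n \<in> (*) (p m) ` B m"
      then obtain k where "n = p m * k" "k \<in> B m" by (rule imageE)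
      with mem show "n \<in> {n \<in> B m. p m dvd n}" by simp
    next
      fix n assume n: "n \<in> {n \<in> B m. p m dvd n}"
      then obtain k where "n = p m * k" by (auto elim: dvdE)
      with n mem show "n \<in> (*) (p m) ` B m" by (intro image_eqI[of _ _ k]) simp_all
    qed
  qed
  have split: "B m = B (Suc m) \<union> (*) (p m) ` B m"
    unfolding img by (auto simp: B_def less_Suc_eq)
  have disj: "B (Suc m) \<inter> (*) (p m) ` B m = {}"
    unfolding img by (auto simp: B_def)
  have "infsum f (B m) = infsum f (B (Suc m)) + infsum f ((*) (p m) ` B m)"
    by (subst split, rule infsum_Un_disjoint[OF summB summB disj])
  also have "infsum f ((*) (p m) ` B m) = f (p m) * infsum f (B m)"
    by (subst infsum_reindex[OF inj]) (simp add: o_def mult infsum_cmult_right summB)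
  finally have "infsum f (B (Suc m)) = (1 - f (p m)) * infsum f (B m)"
    by (subst left_diff_distrib) (metis add_diff_cancel_right' mult_1)
  thus ?case
    using Suc.IH by (simp add: B_def mult_ac)
qed auto

text \<open>After sieving by \<open>m\<close> primes only 1 and numbers \<open>n \<ge> m\<close> can still contribute, so what is left
  differs from \<open>f 1\<close> by at most a tail of the absolutely convergent series. Primes where \<open>f\<close> vanishes
  may be left out of the enumeration \<open>p\<close>; for a character these are the divisors of its modulus.\<close>

lemma euler_product_limit:
  fixes f :: "nat \<Rightarrow> complex" and p :: "nat \<Rightarrow> nat"
  assumes mult: "\<And>m n. f (m * n) = f m * f n" and f0: "f 0 = 0" and f1: "f 1 = 1"
    and summ: "summable (\<lambda>n. norm (f n))"
    and p: "\<And>i. prime (p i)" "strict_mono p"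
    and rest: "\<And>r. prime r \<Longrightarrow> r \<notin> range p \<Longrightarrow> f r = 0"
  shows "(\<lambda>m. (\<Prod>i<m. 1 - f (p i)) * suminf f) \<longlonglongrightarrow> 1"
proof -
  define B where "B k = {n. \<forall>i<k. \<not> p i dvd n}" for k
  have hs: "(f has_sum suminf f) UNIV"
    by (rule norm_summable_imp_has_sum[OF summ]) (use summ summable_norm_cancel in auto)
  have so: "f summable_on X" for X
    by (rule summable_on_subset_banach[of f UNIV]) (use hs summable_on_def in blast)+
  have hsn: "((\<lambda>n. norm (f n)) has_sum (\<Sum>n. norm (f n))) UNIV"
    by (rule norm_summable_imp_has_sum) (use summ in auto)
  have son: "(\<lambda>n. norm (f n)) summable_on X" for X
    by (rule summable_on_subset_banach[of _ UNIV]) (use hsn summable_on_def in blast)+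
  have eq: "(\<Prod>i<m. 1 - f (p i)) * suminf f = infsum f (B m)" for m
    using euler_sieve[OF mult so p(1) strict_mono_imp_inj_on[OF p(2)]] infsumI[OF hs] 
    by (simp add: B_def)
  have pge: "i \<le> p i" for i using p(2) by (rule strict_mono_imp_increasing)
  have bound: "norm (infsum f (B m) - 1) \<le> (\<Sum>n. norm (f n)) - (\<Sum>n<m. norm (f n))" for m
  proof -
    have 1: "1 \<in> B m" using less_imp_neq[OF prime_gt_1_nat[OF p(1)], THEN not_sym] by (simp add: B_def)
    have z: "f n = 0" if n: "n \<in> B m - {1}" "n < m" for n
    proof (rule ccontr)
      assume nz: "f n \<noteq> 0"
      then have "n \<noteq> 0" using f0 by metis
      obtain r where r: "prime r" "r dvd n" using n(1) prime_factor_nat[of n] by auto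
      then obtain k where k: "n = r * k" by blast
      have "f r \<noteq> 0" using nz k mult by auto
      then obtain i where i: "r = p i" using rest r by blast
      have "\<not> i < m" using n(1) r i by (auto simp: B_def)
      moreover have "p i \<le> n" using r i \<open>n \<noteq> 0\<close> by (auto intro: dvd_imp_le)
      ultimately show False using pge[of i] n(2) by linarith
    qed
    have "infsum f (B m) = infsum f {1} + infsum f (B m - {1})"
      using infsum_Un_disjoint[OF so so, of "{1}" "B m - {1}"] 1 by (simp add: insert_absorb)
    hence "norm (infsum f (B m) - 1) = norm (infsum f (B m - {1}))" using f1 by simp
    also have "\<dots> \<le> infsum (\<lambda>n. norm (f n)) (B m - {1})"
      by (rule norm_infsum_bound) (use son in auto)
    also have "\<dots> \<le> infsum (\<lambda>n. norm (f n)) {m..}"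
      by (rule infsum_mono_neutral) (use son z in \<open>auto simp: not_le\<close>)
    also have "\<dots> = (\<Sum>n. norm (f n)) - (\<Sum>n<m. norm (f n))"
    proof -
      have "UNIV = {..<m} \<union> {m..}" "{..<m} \<inter> {m..} = {}" by auto
      hence "infsum (\<lambda>n. norm (f n)) UNIV = infsum (\<lambda>n. norm (f n)) {..<m} + infsum (\<lambda>n. norm (f n)) {m..}"
        using infsum_Un_disjoint[OF son son, of "{..<m}" "{m..}"] by auto
      thus ?thesis using infsumI[OF hsn] by simp
    qed
    finally show ?thesis .
  qed
  have "(\<lambda>m. (\<Sum>n. norm (f n)) - (\<Sum>n<m. norm (f n))) \<longlonglongrightarrow> 0"
    using tendsto_diff[OF tendsto_const[of "\<Sum>n. norm (f n)"] summable_LIMSEQ[OF summ]] by simp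
  hence "(\<lambda>m. infsum f (B m) - 1) \<longlonglongrightarrow> 0"
    by (rule Lim_null_comparison[rotated]) (use bound in auto)
  thus ?thesis unfolding eq by (simp add: LIM_zero_iff)
qed

text \<open>The bound 1/2 keeps every factor away from 0 and makes the principal logarithms summable by
  comparison with \<open>2 * norm (f (p i))\<close>.\<close>

lemma euler_product_exp:
  fixes f :: "nat \<Rightarrow> complex" and p :: "nat \<Rightarrow> nat"
  assumes mult: "\<And>m n. f (m * n) = f m * f n" and f0: "f 0 = 0" and f1: "f 1 = 1"
    and summ: "summable (\<lambda>n. norm (f n))"
    and p: "\<And>i. prime (p i)" "strict_mono p"
    and rest: "\<And>r. prime r \<Longrightarrow> r \<notin> range p \<Longrightarrow> f r = 0"
    and small: "\<And>i. norm (f (p i)) < 1 / 2"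
  shows "suminf f = exp (\<Sum>i. - Ln (1 - f (p i)))"
proof -
  have sp: "summable (\<lambda>i. norm (f (p i)))"
    using summable_reindex[OF summ strict_mono_imp_inj_on[OF p(2)]] by (simp add: o_def)
  have "summable (\<lambda>i. - Ln (1 - f (p i)))"
  proof (rule summable_comparison_test)
    show "\<exists>N. \<forall>n\<ge>N. norm (- Ln (1 - f (p n))) \<le> 2 * norm (f (p n))"
      using norm_Ln_le[of "- f (p _)"] small by fastforce
    show "summable (\<lambda>i. 2 * norm (f (p i)))" using sp by (rule summable_mult)
  qed
  hence "(\<lambda>m. exp (\<Sum>i<m. - Ln (1 - f (p i)))) \<longlonglongrightarrow> exp (\<Sum>i. - Ln (1 - f (p i)))"
    by (intro tendsto_exp summable_LIMSEQ)
  moreover have "exp (\<Sum>i<m. - Ln (1 - f (p i))) = inverse (\<Prod>i<m. 1 - f (p i))" for m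
  proof -
    have nz: "f (p i) \<noteq> 1" for i using small[of i] by auto
    show ?thesis by (simp add: exp_sum exp_minus exp_Ln nz flip: prod_inversef)
  qed
  ultimately have lim: "(\<lambda>m. inverse (\<Prod>i<m. 1 - f (p i))) \<longlonglongrightarrow> exp (\<Sum>i. - Ln (1 - f (p i)))"
    by simp
  have "(\<lambda>m. ((\<Prod>i<m. 1 - f (p i)) * suminf f) * inverse (\<Prod>i<m. 1 - f (p i)))
          \<longlonglongrightarrow> 1 * exp (\<Sum>i. - Ln (1 - f (p i)))"
    by (rule tendsto_mult[OF euler_product_limit[OF mult f0 f1 summ p rest] lim])
  moreover have "((\<Prod>i<m. 1 - f (p i)) * suminf f) * inverse (\<Prod>i<m. 1 - f (p i)) = suminf f" for m
  proof -
    have "1 - f (p i) \<noteq> 0" for i using small[of i] by auto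
    thus ?thesis by simp
  qed
  ultimately show ?thesis by (simp add: LIMSEQ_const_iff)
qed

section \<open>Dirichlet characters\<close>

lemma character_mult: "dirichlet_character q chi \<Longrightarrow> chi (a * b) = chi a * chi b"
  by (simp add: dirichlet_character_def)

lemma character_nonzero_iff: "dirichlet_character q chi \<Longrightarrow> chi a \<noteq> 0 \<longleftrightarrow> coprime a (int q)"
  by (simp add: dirichlet_character_def)

lemma character_1:
  assumes "dirichlet_character q chi"
  shows "chi 1 = 1"
  using character_mult[OF assms, of 1 1] character_nonzero_iff[OF assms, of 1] by simp

text \<open>By Euler's theorem the value at a unit of the residue ring is a root of unity.\<close>

lemma character_unimodular:
  assumes chi: "dirichlet_character q chi" and q: "q \<ge> 1" and a: "coprime a (int q)"
  shows "norm (chi a) = 1"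
proof -
  have mult: "chi (x * y) = chi x * chi y" for x y using chi by (auto simp: dirichlet_character_def)
  have per1: "chi (x + int q) = chi x" for x using chi by (auto simp: dirichlet_character_def)
  have pern: "chi (x + int q * int k) = chi x" for x k
  proof (induction k)
    case (Suc k)
    have "x + int q * int (Suc k) = (x + int q * int k) + int q" by (simp add: algebra_simps)
    then show ?case using Suc per1 by metis
  qed auto
  have one: "chi 1 = 1"
  proof -
    have "chi 1 \<noteq> 0" using chi by (auto simp: dirichlet_character_def)
    thus ?thesis using mult[of 1 1] by simp
  qed
  have pow: "chi (x ^ n) = chi x ^ n" for x n by (induction n) (auto simp: one mult)
  have cong: "chi x = chi y" if xy: "[x = y] (mod int q)" for x y
  proof -
    have *: "chi x = chi y" if "x \<le> y" "[x = y] (mod int q)" for x y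
    proof -
      have "int q dvd y - x" using that(2) by (simp add: cong_iff_dvd_diff dvd_diff_commute)
      then obtain k where k: "y - x = int q * k" by blast
      have "k \<ge> 0" using k that(1) q zero_le_mult_iff[of "int q" k] by auto
      then show ?thesis using pern[of x "nat k"] k by (simp add: algebra_simps)
    qed
    show ?thesis
    proof (cases "x \<le> y")
      case False
      thus ?thesis using *[of y x] cong_sym[OF xy] by simp
    qed (use * xy in blast)
  qed
  define b where "b = nat (a mod int q)"
  have b: "int b = a mod int q" using q by (simp add: b_def)
  have "coprime (int b) (int q)" using a q unfolding b by (metis coprime_mod_left_iff of_nat_eq_0_iff not_one_le_zero)
  hence "[b ^ totient q = 1] (mod q)" using euler_theorem[of b q] by simp
  hence "[int b ^ totient q = 1] (mod int q)" by (metis cong_int_iff of_nat_1 of_nat_power)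
  hence "chi (int b) ^ totient q = 1" using cong one pow by metis
  moreover have "chi (int b) = chi a" by (rule cong) (simp add: b)
  ultimately have "norm (chi a) ^ totient q = 1" by (metis norm_one norm_power)
  moreover have "totient q > 0" using q by simp
  ultimately show ?thesis using power_eq_1_iff[of "norm (chi a)" "totient q"] by simp
qed

lemma character_norm_le:
  assumes "dirichlet_character q chi" "q \<ge> 1"
  shows "norm (chi a) \<le> 1"
  using character_unimodular[OF assms] character_nonzero_iff[OF assms(1), of a]
  by (cases "chi a = 0") auto

section \<open>Completely multiplicative twists\<close>

text \<open>The extension of arbitrary values at the primes to a completely multiplicative function.\<close>

definition twist :: "(nat \<Rightarrow> complex) \<Rightarrow> nat \<Rightarrow> complex" where
  "twist w n = prod_mset (image_mset w (prime_factorization n))"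

lemma twist_mult: "m > 0 \<Longrightarrow> n > 0 \<Longrightarrow> twist w (m * n) = twist w m * twist w n"
  by (simp add: twist_def prime_factorization_mult)

lemma twist_1 [simp]: "twist w (Suc 0) = 1"
  by (simp add: twist_def)

lemma twist_prime: "prime p \<Longrightarrow> twist w p = w p"
  by (simp add: twist_def prime_factorization_prime)

lemma norm_twist:
  assumes "\<And>p. norm (w p) = 1"
  shows "norm (twist w n) = 1"
proof -
  have "norm (prod_mset (image_mset w A)) = 1" for A by (induction A) (auto simp: norm_mult assms)
  thus ?thesis by (simp add: twist_def)
qed

lemma twist_powr:
  assumes "n > 0"
  shows "twist (\<lambda>p. of_nat p powr z) n = of_nat n powr z"
proof -
  have "prod_mset (image_mset (\<lambda>p. (of_nat p :: complex) powr z) A) = of_nat (prod_mset A) powr z" for A :: "nat multiset"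
    by (induction A) (auto simp: powr_times_real)
  from this[of "prime_factorization n"] show ?thesis
    using assms by (simp add: twist_def prod_mset_prime_factorization_nat)
qed

lemma tendsto_twist:
  assumes "\<And>p. prime p \<Longrightarrow> ((\<lambda>m. v m p) \<longlongrightarrow> w p) F"
  shows "((\<lambda>m. twist (v m) n) \<longlongrightarrow> twist w n) F"
proof -
  have "((\<lambda>m. prod_mset (image_mset (v m) A)) \<longlongrightarrow> prod_mset (image_mset w A)) F"
    if "\<And>p. p \<in># A \<Longrightarrow> prime p" for A :: "nat multiset"
    using that by (induction A) (auto intro!: tendsto_intros assms)
  from this[of "prime_factorization n"] show ?thesis
    unfolding twist_def by (auto intro: in_prime_factors_imp_prime)
qed

section \<open>Kronecker's theorem for the logarithms of the primes\<close>

text \<open>Unique factorisation: separating positive and negative coefficients and exponentiating gives an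
  equality of two products of prime powers, in which the multiplicities of \<open>r\<close> must agree.\<close>

lemma ln_primes_independent:
  fixes c :: "nat \<Rightarrow> int"
  assumes Q: "finite Q" "\<And>r. r \<in> Q \<Longrightarrow> prime r" and 0: "(\<Sum>r\<in>Q. of_int (c r) * ln (real r)) = 0"
    and r: "r \<in> Q"
  shows "c r = 0"
proof -
  have pos: "real r > 0" if "r \<in> Q" for r using Q(2)[OF that] prime_gt_0_nat by simp
  have e: "exp (\<Sum>r\<in>Q. real (f r) * ln (real r)) = real (\<Prod>r\<in>Q. r ^ f r)" for f :: "nat \<Rightarrow> nat"
  proof -
    have "exp (real (f r) * ln (real r)) = real r ^ f r" if "r \<in> Q" for r
      using pos[OF that] by (simp add: exp_of_nat_mult)
    thus ?thesis using Q(1) by (simp add: exp_sum)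
  qed
  have "of_int (c r) = real (nat (c r)) - real (nat (- c r))" for r by auto
  hence "(\<Sum>r\<in>Q. real (nat (c r)) * ln (real r)) = (\<Sum>r\<in>Q. real (nat (- c r)) * ln (real r))"
    using 0 by (simp add: left_diff_distrib sum_subtractf)
  hence "real (\<Prod>r\<in>Q. r ^ nat (c r)) = real (\<Prod>r\<in>Q. r ^ nat (- c r))"
    using e[of "\<lambda>r. nat (c r)"] e[of "\<lambda>r. nat (- c r)"] by simp
  hence eq: "(\<Prod>r\<in>Q. r ^ nat (c r)) = (\<Prod>r\<in>Q. r ^ nat (- c r))" using of_nat_eq_iff by blast
  have "multiplicity r (\<Prod>r\<in>Q. r ^ f r) = f r" for f :: "nat \<Rightarrow> nat"
    using multiplicity_prod_prime_powers[OF Q(1), of r f] Q(2) r by auto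
  hence "nat (c r) = nat (- c r)" using eq by metis
  thus ?thesis by linarith
qed

text \<open>The factor \<open>- 1 / (2 * pi)\<close> turns \<open>p powr (- \<i> t)\<close> into \<open>exp (2 pi \<i> t \<theta>)\<close>, the normalisation
  in which Kronecker's theorem approximates modulo 1.\<close>

lemma independent_ln_primes:
  fixes p :: "nat \<Rightarrow> nat"
  assumes p: "\<And>i. prime (p i)" "inj p"
  shows "module.independent (\<lambda>r. (*) (real_of_int r)) ((\<lambda>i. - ln (real (p i)) / (2 * pi)) ` {..<n})"
    and "inj_on (\<lambda>i. - ln (real (p i)) / (2 * pi)) {..<n}"
proof -
  define \<theta> where "\<theta> i = - ln (real (p i)) / (2 * pi)" for i
  have inj: "inj \<theta>"
  proof (rule injI)
    fix i j assume "\<theta> i = \<theta> j"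
    hence "ln (real (p i)) = ln (real (p j))" by (simp add: \<theta>_def)
    hence "p i = p j" using prime_gt_0_nat[OF p(1)] by simp
    thus "i = j" using p(2) by (simp add: injD)
  qed
  thus "inj_on (\<lambda>i. - ln (real (p i)) / (2 * pi)) {..<n}"
    unfolding \<theta>_def by (rule inj_on_subset) auto
  interpret Modules.module "\<lambda>r. (*) (real_of_int r)"
    by (simp add: Modules.module.intro distrib_left mult.commute)
  have "independent (\<theta> ` {..<n})"
  proof
    assume "dependent (\<theta> ` {..<n})"
    then obtain T u where T: "finite T" "T \<subseteq> \<theta> ` {..<n}" "(\<Sum>v\<in>T. of_int (u v) * v) = 0"
      and nz: "\<exists>v\<in>T. u v \<noteq> 0" unfolding dependent_explicit by blast
    from T(2) obtain I where I: "I \<subseteq> {..<n}" "T = \<theta> ` I" by (meson subset_imageE)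
    have finI: "finite I" using finite_subset[OF I(1)] by simp
    have "(\<Sum>i\<in>I. of_int (u (\<theta> i)) * \<theta> i) = 0"
      using T(3) unfolding I(2) by (simp add: sum.reindex inj_on_subset[OF inj])
    moreover have "(\<Sum>i\<in>I. of_int (u (\<theta> i)) * \<theta> i) = - (\<Sum>i\<in>I. of_int (u (\<theta> i)) * ln (real (p i))) / (2 * pi)"
      by (simp add: \<theta>_def sum_divide_distrib sum_negf)
    ultimately have "(\<Sum>i\<in>I. of_int (u (\<theta> i)) * ln (real (p i))) = 0" by simp
    hence *: "(\<Sum>r\<in>p ` I. of_int (u (\<theta> (inv_into UNIV p r))) * ln (real r)) = 0"
      using p(2) by (simp add: sum.reindex inj_on_subset[OF p(2)])
    have "u (\<theta> i) = 0" if "i \<in> I" for i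
    proof -
      have "u (\<theta> (inv_into UNIV p (p i))) = 0"
        by (rule ln_primes_independent[OF _ _ *]) (use that finI p(1) in auto)
      thus ?thesis using p(2) by simp
    qed
    thus False using nz I(2) by auto
  qed
  thus "module.independent (\<lambda>r. (*) (real_of_int r)) ((\<lambda>i. - ln (real (p i)) / (2 * pi)) ` {..<n})"
    unfolding \<theta>_def .
qed

text \<open>Every unimodular twist is a pointwise limit of the vertical shifts \<open>n powr (- \<i> t)\<close>: the \<open>m\<close>-th shift is
  chosen close to \<open>w\<close> at the first \<open>m\<close> primes, and convergence at the primes spreads to all
  positive integers by multiplicativity.\<close>

lemma kronecker_primes:
  assumes w: "\<And>p. norm (w p) = 1"
  obtains t :: "nat \<Rightarrow> real" where "\<And>n. n > 0 \<Longrightarrow> (\<lambda>m. of_nat n powr (- (\<i> * of_real (t m)))) \<longlonglongrightarrow> twist w n"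
proof -
  define p where "p = enumerate {p :: nat. prime p}"
  have inf: "infinite {p :: nat. prime p}" by (rule primes_infinite)
  have p: "prime (p i)" for i using enumerate_in_set[OF inf] by (auto simp: p_def)
  have inj: "inj p" unfolding p_def by (rule strict_mono_imp_inj_on[OF strict_mono_enumerate[OF inf]])
  have surj: "r \<in> range p" if "prime r" for r using that range_enumerate[OF inf] by (simp add: p_def)
  define \<theta> where "\<theta> i = - ln (real (p i)) / (2 * pi)" for i
  define \<alpha> where "\<alpha> i = Arg (w (p i)) / (2 * pi)" for i
  have "\<exists>t. \<exists>h::nat\<Rightarrow>int. \<forall>i<m. \<bar>t * \<theta> i - of_int (h i) - \<alpha> i\<bar> < 1 / real (Suc m)" for m
    using Kronecker_thm_1[OF independent_ln_primes[OF p inj], of "1 / real (Suc m)" m \<alpha>]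
    unfolding \<theta>_def by (metis of_nat_0_less_iff zero_less_Suc zero_less_divide_1_iff)
  then obtain t and h :: "nat \<Rightarrow> nat \<Rightarrow> int"
    where th: "\<And>m i. i < m \<Longrightarrow> \<bar>t m * \<theta> i - of_int (h m i) - \<alpha> i\<bar> < 1 / real (Suc m)" by metis
  have lim_p: "(\<lambda>m. of_nat (p i) powr (- (\<i> * of_real (t m)))) \<longlonglongrightarrow> w (p i)" for i
  proof -
    define x where "x m = t m * \<theta> i - of_int (h m i) - \<alpha> i" for m
    have x0: "x \<longlonglongrightarrow> 0"
    proof (rule Lim_null_comparison)
      show "\<forall>\<^sub>F m in sequentially. norm (x m) \<le> 1 / real (Suc m)"
        using eventually_gt_at_top[of i] by eventually_elim (use th in \<open>auto simp: x_def intro: less_imp_le\<close>)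
    qed (rule LIMSEQ_Suc[OF lim_1_over_n])
    have "(\<lambda>m. w (p i) * exp (2 * pi * \<i> * x m)) \<longlonglongrightarrow> w (p i) * exp (2 * pi * \<i> * complex_of_real 0)"
      by (intro tendsto_intros x0)
    moreover have "w (p i) * exp (2 * pi * \<i> * x m) = of_nat (p i) powr (- (\<i> * of_real (t m)))" for m
    proof -
      have wne: "w (p i) \<noteq> 0" using w[of "p i"] by auto
      have "w (p i) = exp (\<i> * Arg (w (p i)))"
        using Arg_eq[OF wne] by (simp add: w)
      also have "\<dots> = exp (2 * pi * \<i> * \<alpha> i)" by (simp add: \<alpha>_def)
      finally have "w (p i) * exp (2 * pi * \<i> * x m) = exp (2 * pi * \<i> * (\<alpha> i + x m))"
        by (simp add: algebra_simps flip: exp_add)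
      also have "2 * pi * \<i> * (\<alpha> i + x m) = \<i> * complex_of_real (t m) * of_real (2 * pi * \<theta> i) + (2 * of_int (- h m i) * pi) * \<i>"
        by (simp add: x_def algebra_simps)
      also have "exp \<dots> = exp (\<i> * complex_of_real (t m) * of_real (2 * pi * \<theta> i))"
        by (subst exp_add, subst exp_integer_2pi) auto
      also have "\<dots> = of_nat (p i) powr (- (\<i> * of_real (t m)))"
        using prime_gt_0_nat[OF p[of i]] by (simp add: \<theta>_def powr_def Ln_of_nat mult_ac)
      finally show ?thesis .
    qed
    ultimately show ?thesis by simp
  qed
  have "(\<lambda>m. twist (\<lambda>p. of_nat p powr (- (\<i> * of_real (t m)))) n) \<longlonglongrightarrow> twist w n" for n
    by (rule tendsto_twist) (use lim_p surj in auto)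
  note lim = this
  show ?thesis
  proof (rule that[of t])
    fix n :: nat assume "n > 0"
    thus "(\<lambda>m. of_nat n powr (- (\<i> * of_real (t m)))) \<longlonglongrightarrow> twist w n"
      using lim[of n] by (simp add: twist_powr)
  qed
qed

section \<open>Twisted series\<close>

text \<open>The twist sits inside the \<open>k\<close>-th power, so that a single \<open>u\<close> acts on all the series
  \<open>L(k s, chi)\<close> at once, as a vertical shift of \<open>s\<close> does.\<close>

definition twisted_L :: "(int \<Rightarrow> complex) \<Rightarrow> (nat \<Rightarrow> complex) \<Rightarrow> nat \<Rightarrow> complex \<Rightarrow> complex" where
  "twisted_L chi u k s = (\<Sum>n. chi (int (Suc n)) * (u (Suc n) * of_nat (Suc n) powr (- s)) ^ k)"

lemma norm_twisted_L_term:
  assumes "norm (chi (int (Suc n))) \<le> 1" "norm (u (Suc n)) \<le> 1" "\<sigma> \<le> real k * Re s"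
  shows "norm (chi (int (Suc n)) * (u (Suc n) * of_nat (Suc n) powr (- s)) ^ k) \<le> real (Suc n) powr - \<sigma>"
proof -
  have n: "norm (of_nat (Suc n) powr (- s)) = real (Suc n) powr (- Re s)"
    by (subst norm_powr_real_powr) auto
  have "norm (chi (int (Suc n)) * (u (Suc n) * of_nat (Suc n) powr (- s)) ^ k)
          = norm (chi (int (Suc n))) * norm (u (Suc n)) ^ k * (real (Suc n) powr (- Re s)) ^ k"
    by (simp only: norm_mult norm_power n power_mult_distrib mult.assoc)
  also have "\<dots> \<le> 1 * 1 * (real (Suc n) powr (- Re s)) ^ k"
    using assms by (intro mult_mono power_le_one) auto
  also have "\<dots> = real (Suc n) powr (- (real k * Re s))"
    by (subst powr_power) (auto simp: mult_ac)
  also have "\<dots> \<le> real (Suc n) powr - \<sigma>"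
    using assms by (intro powr_mono) auto
  finally show ?thesis .
qed

lemma summable_Suc_powr: "\<sigma> > 1 \<Longrightarrow> summable (\<lambda>n. real (Suc n) powr - \<sigma>)"
  by (subst summable_Suc_iff) (simp add: summable_real_powr_iff)

lemma le_mult_Re: "k \<ge> 1 \<Longrightarrow> \<sigma> \<le> Re s \<Longrightarrow> \<sigma> > 0 \<Longrightarrow> \<sigma> \<le> real k * Re s"
  using mult_mono[of 1 "real k" \<sigma> "Re s"] by simp

lemma twisted_L_holomorphic:
  assumes chi: "\<And>n. norm (chi n) \<le> 1" and u: "\<And>n. norm (u n) \<le> 1" and k: "k \<ge> 1"
  shows "twisted_L chi u k holomorphic_on {s. Re s > 1}"
proof (rule holomorphic_uniform_sequence)
  show "open {s. Re s > 1}" by (rule open_halfspace_Re_gt)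
  show "(\<lambda>s. \<Sum>n<m. chi (int (Suc n)) * (u (Suc n) * of_nat (Suc n) powr (- s)) ^ k)
          holomorphic_on {s. Re s > 1}" for m
    by (intro holomorphic_intros)
  fix x :: complex assume x: "x \<in> {s. Re s > 1}"
  define d where "d = (Re x - 1) / 2"
  have d: "d > 0" using x by (simp add: d_def)
  have Re: "Re s \<ge> 1 + d" if "s \<in> cball x d" for s
  proof -
    have "\<bar>Re x - Re s\<bar> \<le> d" using that abs_Re_le_cmod[of "x - s"] by (simp add: dist_norm)
    moreover have "Re x = 1 + 2 * d" by (simp add: d_def field_simps)
    ultimately show ?thesis by linarith
  qed
  have "uniform_limit (cball x d)
     (\<lambda>m s. \<Sum>n<m. chi (int (Suc n)) * (u (Suc n) * of_nat (Suc n) powr (- s)) ^ k)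
     (\<lambda>s. twisted_L chi u k s) sequentially"
    unfolding twisted_L_def
  proof (rule Weierstrass_m_test)
    show "summable (\<lambda>n. real (Suc n) powr - (1 + d))" using d by (intro summable_Suc_powr) auto
    show "norm (chi (int (Suc n)) * (u (Suc n) * of_nat (Suc n) powr (- s)) ^ k) \<le> real (Suc n) powr - (1 + d)"
      if "s \<in> cball x d" for n s
      using Re[OF that] d by (intro norm_twisted_L_term chi u le_mult_Re k) auto
  qed
  moreover have "cball x d \<subseteq> {s. Re s > 1}" using Re d by force
  ultimately show "\<exists>d>0. cball x d \<subseteq> {s. Re s > 1} \<and> uniform_limit (cball x d)
     (\<lambda>m s. \<Sum>n<m. chi (int (Suc n)) * (u (Suc n) * of_nat (Suc n) powr (- s)) ^ k)
     (twisted_L chi u k) sequentially"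
    using d by auto
qed

text \<open>The terms after the first are dominated by those of the series of inverse squares, and
  \<open>pi\<^sup>2 / 6 - 1 < 71 / 100\<close>. What matters later is that the bound is below 1.\<close>

lemma twisted_L_near_1:
  assumes chi: "\<And>n. norm (chi n) \<le> 1" and u: "\<And>n. norm (u n) \<le> 1"
    and 1: "chi 1 = 1" "u (Suc 0) = 1" and s: "real k * Re s \<ge> 2"
  shows "norm (twisted_L chi u k s - 1) \<le> 71 / 100"
proof -
  define t where "t n = chi (int (Suc n)) * (u (Suc n) * of_nat (Suc n) powr (- s)) ^ k" for n
  have b: "norm (t n) \<le> real (Suc n) powr - 2" for n
    unfolding t_def using s by (intro norm_twisted_L_term chi u) auto
  have sq: "(\<lambda>n. real (Suc n) powr - 2) sums (pi\<^sup>2 / 6)"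
    using inverse_squares_sums by (simp add: powr_minus powr_numeral field_simps)
  have st: "summable t"
    by (rule summable_comparison_test[OF _ sums_summable[OF sq]]) (use b in auto)
  have sq': "(\<lambda>n. real (Suc (Suc n)) powr - 2) sums (pi\<^sup>2 / 6 - 1)"
    using sq by (subst sums_Suc_iff) simp
  have "twisted_L chi u k s = suminf t" unfolding twisted_L_def t_def ..
  moreover have "t 0 = 1" using 1 by (simp add: t_def)
  ultimately have "twisted_L chi u k s - 1 = (\<Sum>n. t (Suc n))"
    using suminf_split_head[OF st] by simp
  also have "norm \<dots> \<le> (\<Sum>n. real (Suc (Suc n)) powr - 2)"
    by (rule norm_suminf_le[OF b sums_summable[OF sq']])
  also have "\<dots> = pi\<^sup>2 / 6 - 1" using sq' by (simp add: sums_iff)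
  also have "\<dots> \<le> 71 / 100"
  proof -
    have "pi \<le> 16 / 5" using pi_approx by simp
    hence "pi\<^sup>2 \<le> (16 / 5)\<^sup>2" by (intro power_mono) auto
    thus ?thesis by (simp add: power2_eq_square)
  qed
  finally show ?thesis .
qed

text \<open>The difference is bounded, independently of \<open>s\<close>, by the same weighted sum of the distances of the
  twists, which tends to 0 by dominated convergence.\<close>

lemma twisted_L_uniform_limit:
  assumes chi: "\<And>n. norm (chi n) \<le> 1"
    and v: "\<And>m n. norm (v m n) \<le> 1" and u: "\<And>n. norm (u n) \<le> 1"
    and lim: "\<And>n. n > 0 \<Longrightarrow> (\<lambda>m. v m n) \<longlonglongrightarrow> u n"
    and k: "k \<ge> 1" and \<sigma>: "\<sigma> > 1"
  shows "uniform_limit {s. Re s \<ge> \<sigma>} (\<lambda>m. twisted_L chi (v m) k) (twisted_L chi u k) sequentially"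
proof -
  define e where "e m = (\<Sum>n. norm (chi (int (Suc n)) * (v m (Suc n) ^ k - u (Suc n) ^ k)) * real (Suc n) powr - \<sigma>)" for m
  have le2: "norm (chi (int (Suc n)) * (v m (Suc n) ^ k - u (Suc n) ^ k)) \<le> 2" for m n
  proof -
    have "norm (v m (Suc n) ^ k - u (Suc n) ^ k) \<le> 1 + 1"
      by (intro order.trans[OF norm_triangle_ineq4] add_mono) (auto simp: norm_power power_le_one v u)
    thus ?thesis using mult_mono[OF chi[of "int (Suc n)"], of "norm (v m (Suc n) ^ k - u (Suc n) ^ k)" 2]
      by (simp add: norm_mult)
  qed
  have b2: "norm (norm (chi (int (Suc n)) * (v m (Suc n) ^ k - u (Suc n) ^ k)) * real (Suc n) powr - \<sigma>) \<le> 2 * real (Suc n) powr - \<sigma>" for m n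
    using mult_right_mono[OF le2[of n m], of "real (Suc n) powr - \<sigma>"] by (simp add: abs_mult norm_mult)
  have sm2: "summable (\<lambda>n. 2 * real (Suc n) powr - \<sigma>)"
    by (intro summable_mult summable_Suc_powr \<sigma>)
  have e0: "e \<longlonglongrightarrow> (\<Sum>n. 0 :: real)"
    unfolding e_def
  proof (rule tannerys_theorem[where M = "\<lambda>n. 2 * real (Suc n) powr - \<sigma>", THEN conjunct2, THEN conjunct2])
    fix n
    show "(\<lambda>m. norm (chi (int (Suc n)) * (v m (Suc n) ^ k - u (Suc n) ^ k)) * real (Suc n) powr - \<sigma>) \<longlonglongrightarrow> 0"
    proof -
      have "(\<lambda>m. norm (chi (int (Suc n)) * (v m (Suc n) ^ k - u (Suc n) ^ k)) * real (Suc n) powr - \<sigma>)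
         \<longlonglongrightarrow> norm (chi (int (Suc n)) * (u (Suc n) ^ k - u (Suc n) ^ k)) * real (Suc n) powr - \<sigma>"
        by (intro tendsto_intros lim) auto
      thus ?thesis by simp
    qed
  next
    show "\<forall>\<^sub>F (n, m) in at_top \<times>\<^sub>F sequentially. norm (norm (chi (int (Suc n)) * (v m (Suc n) ^ k - u (Suc n) ^ k)) * real (Suc n) powr - \<sigma>) \<le> 2 * real (Suc n) powr - \<sigma>"
      using b2 by (intro always_eventually) auto
  qed (use sm2 in auto)
  have bound: "dist (twisted_L chi (v m) k s) (twisted_L chi u k s) \<le> e m" if s: "Re s \<ge> \<sigma>" for m s
  proof -
    have sw: "summable (\<lambda>n. chi (int (Suc n)) * (w (Suc n) * of_nat (Suc n) powr (- s)) ^ k)"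
      if w: "\<And>n. norm (w n) \<le> 1" for w
    proof (rule summable_comparison_test[OF _ summable_Suc_powr[OF \<sigma>]], intro exI allI impI)
      show "norm (chi (int (Suc n)) * (w (Suc n) * of_nat (Suc n) powr (- s)) ^ k) \<le> real (Suc n) powr - \<sigma>" for n
        using \<sigma> by (intro norm_twisted_L_term chi w le_mult_Re k s) auto
    qed
    have "twisted_L chi (v m) k s - twisted_L chi u k s =
      (\<Sum>n. chi (int (Suc n)) * (v m (Suc n) * of_nat (Suc n) powr (- s)) ^ k - chi (int (Suc n)) * (u (Suc n) * of_nat (Suc n) powr (- s)) ^ k)"
      unfolding twisted_L_def by (intro suminf_diff sw v u)
    also have "norm \<dots> \<le> e m"
      unfolding e_def
    proof (rule norm_suminf_le)
      show "summable (\<lambda>n. norm (chi (int (Suc n)) * (v m (Suc n) ^ k - u (Suc n) ^ k)) * real (Suc n) powr - \<sigma>)"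
        by (rule summable_comparison_test[OF _ sm2]) (use b2 in auto)
      fix n
      have "chi (int (Suc n)) * (v m (Suc n) * of_nat (Suc n) powr (- s)) ^ k - chi (int (Suc n)) * (u (Suc n) * of_nat (Suc n) powr (- s)) ^ k
          = (chi (int (Suc n)) * (v m (Suc n) ^ k - u (Suc n) ^ k)) * (1 * (1 * of_nat (Suc n) powr (- s)) ^ k)"
        by (simp add: power_mult_distrib algebra_simps)
      also have "norm \<dots> \<le> norm (chi (int (Suc n)) * (v m (Suc n) ^ k - u (Suc n) ^ k)) * real (Suc n) powr - \<sigma>"
        unfolding norm_mult[of "chi (int (Suc n)) * (v m (Suc n) ^ k - u (Suc n) ^ k)"]
        by (intro mult_left_mono norm_twisted_L_term[where chi = "\<lambda>_. 1" and u = "\<lambda>_. 1"] le_mult_Re k s)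
          (use \<sigma> in auto)
      finally show "norm (chi (int (Suc n)) * (v m (Suc n) * of_nat (Suc n) powr (- s)) ^ k - chi (int (Suc n)) * (u (Suc n) * of_nat (Suc n) powr (- s)) ^ k)
          \<le> norm (chi (int (Suc n)) * (v m (Suc n) ^ k - u (Suc n) ^ k)) * real (Suc n) powr - \<sigma>" .
    qed
    finally show ?thesis by (simp add: dist_norm)
  qed
  show ?thesis
  proof (rule uniform_limitI)
    fix \<epsilon> :: real assume "\<epsilon> > 0"
    hence "\<forall>\<^sub>F m in sequentially. e m < \<epsilon>"
      using e0 by (intro order_tendstoD) auto
    thus "\<forall>\<^sub>F m in sequentially. \<forall>s\<in>{s. Re s \<ge> \<sigma>}. dist (twisted_L chi (v m) k s) (twisted_L chi u k s) < \<epsilon>"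
      by eventually_elim (use bound in \<open>auto intro: le_less_trans\<close>)
  qed
qed

lemma twisted_L_shift:
  "twisted_L chi (\<lambda>n. of_nat n powr (- (\<i> * of_real t))) k s = dirichlet_L chi (of_nat k * (s + \<i> * of_real t))"
proof -
  have "(complex_of_nat (Suc n) powr (- (\<i> * of_real t)) * of_nat (Suc n) powr (- s)) ^ k
      = of_nat (Suc n) powr (- (of_nat k * (s + \<i> * of_real t)))" for n
  proof -
    have "(of_nat (Suc n) :: complex) \<noteq> 0" by (simp del: of_nat_Suc)
    thus ?thesis
      by (simp add: powr_def algebra_simps del: of_nat_Suc flip: exp_add exp_of_nat_mult)
  qed
  thus ?thesis unfolding twisted_L_def dirichlet_L_def by simp
qed

lemma continuous_on_suminf:
  fixes f :: "nat \<Rightarrow> 'a::topological_space \<Rightarrow> 'b::banach"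
  assumes "\<And>n. continuous_on A (f n)" "\<And>n x. x \<in> A \<Longrightarrow> norm (f n x) \<le> M n" "summable M"
  shows "continuous_on A (\<lambda>x. \<Sum>n. f n x)"
  by (rule uniform_limit_theorem[OF _ Weierstrass_m_test[OF assms(2,3)]])
     (auto intro!: always_eventually continuous_on_sum assms(1))

lemma twisted_L_continuous_on:
  fixes w :: "'a :: topological_space \<Rightarrow> nat \<Rightarrow> complex"
  assumes chi: "\<And>n. norm (chi n) \<le> 1" and w: "\<And>v p. v \<in> A \<Longrightarrow> norm (w v p) = 1"
    and cont: "\<And>p. continuous_on A (\<lambda>v. w v p)" and k: "k \<ge> 1" and s: "Re s > 1"
  shows "continuous_on A (\<lambda>v. twisted_L chi (twist (w v)) k s)"
  unfolding twisted_L_def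
proof (rule continuous_on_suminf)
  have "continuous_on A (\<lambda>v. twist (w v) n)" for n
    unfolding continuous_on_def by (intro ballI tendsto_twist) (use cont in \<open>auto simp: continuous_on_def\<close>)
  thus "continuous_on A (\<lambda>v. chi (int (Suc n)) * (twist (w v) (Suc n) * of_nat (Suc n) powr (- s)) ^ k)" for n
    by (intro continuous_intros)
  show "norm (chi (int (Suc n)) * (twist (w v) (Suc n) * of_nat (Suc n) powr (- s)) ^ k) \<le> real (Suc n) powr - Re s"
    if "v \<in> A" for n v
    using s norm_twist[OF w[OF that]] by (intro norm_twisted_L_term chi le_mult_Re k) auto
qed (rule summable_Suc_powr[OF s])

section \<open>Primes not dividing the modulus\<close>

definition unramified_prime :: "nat \<Rightarrow> nat \<Rightarrow> nat" where
  "unramified_prime q = enumerate {p. prime p \<and> \<not> p dvd q}"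

context
  fixes q :: nat
  assumes q: "q \<ge> 1"
begin

lemma infinite_unramified: "infinite {p. prime p \<and> \<not> p dvd q}"
proof
  assume "finite {p. prime p \<and> \<not> p dvd q}"
  moreover have "finite {p. p dvd q}" using q by simp
  ultimately have "finite ({p. prime p \<and> \<not> p dvd q} \<union> {p. p dvd q})" by blast
  hence "finite {p :: nat. prime p}" by (rule finite_subset[rotated]) auto
  thus False using primes_infinite by blast
qed

lemma unramified_prime: "prime (unramified_prime q i)" "coprime (unramified_prime q i) q"
  using enumerate_in_set[OF infinite_unramified, of i]
  by (auto simp: unramified_prime_def prime_imp_coprime)

lemma strict_mono_unramified_prime: "strict_mono (unramified_prime q)"
  unfolding unramified_prime_def by (rule strict_mono_enumerate[OF infinite_unramified])

lemma range_unramified_prime: "range (unramified_prime q) = {p. prime p \<and> \<not> p dvd q}"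
  unfolding unramified_prime_def by (rule range_enumerate[OF infinite_unramified])

lemma unramified_prime_ge: "unramified_prime q i \<ge> Suc i"
proof (induction i)
  case 0
  show ?case using prime_gt_0_nat[OF unramified_prime(1)[of 0]] by simp
next
  case (Suc i)
  thus ?case using strict_monoD[OF strict_mono_unramified_prime, of i "Suc i"] by simp
qed

lemma unramified_prime_powr:
  assumes \<sigma>: "\<sigma> > 1"
  defines "r \<equiv> \<lambda>i. real (unramified_prime q i) powr - \<sigma>"
  shows "r i > 0" "r i < 1 / 2" "r i \<le> real (Suc i) powr - \<sigma>" "decseq r" "summable r"
proof -
  have ge2: "real (unramified_prime q i) \<ge> 2" for i
    using prime_ge_2_nat[OF unramified_prime(1)[of i]] by simp
  show "r i > 0" using ge2[of i] by (simp add: r_def)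
  have "r i \<le> 2 powr - \<sigma>" unfolding r_def using ge2[of i] \<sigma> by (intro powr_mono2') auto
  also have "\<dots> < 2 powr - 1" using \<sigma> by (intro powr_less_mono) auto
  finally show "r i < 1 / 2" by (simp add: powr_minus)
  have le: "r i \<le> real (Suc i) powr - \<sigma>" for i
    unfolding r_def using unramified_prime_ge[of i] \<sigma> by (intro powr_mono2') auto
  show "r i \<le> real (Suc i) powr - \<sigma>" by (rule le)
  show "decseq r"
  proof (rule decseq_SucI)
    fix n
    have "unramified_prime q n \<le> unramified_prime q (Suc n)"
      using strict_monoD[OF strict_mono_unramified_prime, of n "Suc n"] by simp
    thus "r (Suc n) \<le> r n" unfolding r_def using ge2[of n] \<sigma> by (intro powr_mono2') auto
  qed
  show "summable r"
    by (rule summable_comparison_test[OF _ summable_Suc_powr[OF \<sigma>]]) (use le in \<open>auto simp: r_def\<close>)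
qed

text \<open>The Euler product of the principal character at a real \<open>\<sigma>\<close>, bounded from above through its
  logarithm and from below by the terms with \<open>n\<close> congruent to 1 modulo \<open>q\<close>.\<close>

lemma coprime_sum_le_exp:
  assumes \<sigma>: "\<sigma> > 1"
  shows "(\<Sum>j<J. real (1 + j * q) powr - \<sigma>) \<le> exp (2 * (\<Sum>i. real (unramified_prime q i) powr - \<sigma>))"
proof -
  define g where "g n = (if coprime n q then real n powr - \<sigma> else 0)" for n
  define f where "f n = complex_of_real (g n)" for n
  define p where "p = unramified_prime q"
  note r = unramified_prime_powr[OF \<sigma>]
  have g0: "g n \<ge> 0" for n by (simp add: g_def)
  have sg: "summable g"
  proof (rule summable_comparison_test)
    show "summable (\<lambda>n. real n powr - \<sigma>)" using \<sigma> by (simp add: summable_real_powr_iff)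
  qed (auto simp: g_def)
  have fp: "f (p i) = real (p i) powr - \<sigma>" for i
    using unramified_prime(2)[of i] by (simp add: f_def g_def p_def)
  have small: "norm (f (p i)) < 1 / 2" for i
    unfolding fp using r(2)[of i] by (simp add: p_def)
  have "suminf f = exp (\<Sum>i. - Ln (1 - f (p i)))"
  proof (rule euler_product_exp)
    show "f (m * n) = f m * f n" for m n
      by (simp add: f_def g_def powr_mult)
    show "f 0 = 0" "f 1 = 1" by (simp_all add: f_def g_def)
    show "summable (\<lambda>n. norm (f n))" using sg g0 by (simp add: f_def)
    show "prime (p i)" for i by (simp add: p_def unramified_prime)
    show "strict_mono p" by (simp add: p_def strict_mono_unramified_prime)
    show "f s = 0" if s: "prime s" "s \<notin> range p" for s
    proof -
      have "s dvd q" using s by (simp add: p_def range_unramified_prime)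
      hence "\<not> coprime s q" using s(1) by (meson coprime_absorb_left not_prime_unit)
      thus ?thesis by (simp add: f_def g_def)
    qed
  qed (rule small)
  moreover have "suminf f = of_real (suminf g)"
    unfolding f_def by (rule suminf_of_real[OF sg, symmetric])
  ultimately have eq: "of_real (suminf g) = exp (\<Sum>i. - Ln (1 - f (p i)))" by simp
  have "suminf g = norm (complex_of_real (suminf g))"
    using suminf_nonneg[OF sg g0] by simp
  also have "\<dots> = exp (Re (\<Sum>i. - Ln (1 - f (p i))))" unfolding eq by simp
  also have "\<dots> \<le> exp (norm (\<Sum>i. - Ln (1 - f (p i))))" using complex_Re_le_cmod by simp
  also have "norm (\<Sum>i. - Ln (1 - f (p i))) \<le> (\<Sum>i. 2 * (real (p i) powr - \<sigma>))"
  proof (rule norm_suminf_le)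
    show "norm (- Ln (1 - f (p i))) \<le> 2 * (real (p i) powr - \<sigma>)" for i
      using norm_Ln_le[of "- f (p i)"] small[of i] by (simp add: fp)
    show "summable (\<lambda>i. 2 * (real (p i) powr - \<sigma>))"
      using r(5) by (intro summable_mult) (simp add: p_def)
  qed
  also have "\<dots> = 2 * (\<Sum>i. real (p i) powr - \<sigma>)"
    by (rule suminf_mult) (use r(5) in \<open>simp add: p_def\<close>)
  finally have ub: "suminf g \<le> exp (2 * (\<Sum>i. real (p i) powr - \<sigma>))" by simp
  have inj: "inj_on (\<lambda>j. 1 + j * q) {..<J}" using q by (auto simp: inj_on_def)
  have "coprime (1 + j * q) q" for j
    by (metis coprime_1_left coprime_mod_left_iff mod_mult_self1 mult_is_0 not_one_le_zero q)
  hence "(\<Sum>j<J. real (1 + j * q) powr - \<sigma>) = (\<Sum>j<J. g (1 + j * q))" by (simp add: g_def)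
  also have "\<dots> = sum g ((\<lambda>j. 1 + j * q) ` {..<J})" by (simp only: sum.reindex[OF inj] o_def)
  also have "\<dots> \<le> suminf g" by (rule sum_le_suminf[OF sg]) (use g0 in auto)
  finally show ?thesis using ub by (simp add: p_def)
qed

text \<open>The lower bound of the preceding lemma is continuous in \<open>\<sigma>\<close> for fixed \<open>J\<close>, and at \<open>\<sigma> = 1\<close> it is
  unbounded in \<open>J\<close> by comparison with the harmonic series.\<close>

lemma prime_sum_large:
  "\<forall>\<^sub>F \<sigma> in at_right 1. K \<le> (\<Sum>i. real (unramified_prime q i) powr - \<sigma>)"
proof -
  have "\<exists>J. (\<Sum>j<J. real (1 + j * q) powr - 1) > exp (2 * K)"
  proof (rule ccontr)
    assume "\<not> ?thesis"
    hence b: "(\<Sum>j<J. real (1 + j * q) powr - 1) \<le> exp (2 * K)" for J by (simp add: not_less)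
    have "(\<Sum>j<J. inverse (real (Suc j))) \<le> real q * exp (2 * K)" for J
    proof -
      have "inverse (real (Suc j)) \<le> real q * (real (1 + j * q) powr - 1)" for j
      proof -
        have "1 + j * q \<le> q * Suc j" using q by (simp add: algebra_simps)
        hence "real (1 + j * q) \<le> real q * real (Suc j)" by (metis of_nat_le_iff of_nat_mult)
        moreover have "real (1 + j * q) > 0" unfolding of_nat_0_less_iff by simp
        ultimately show ?thesis by (simp add: powr_minus divide_simps mult_ac)
      qed
      hence "(\<Sum>j<J. inverse (real (Suc j))) \<le> (\<Sum>j<J. real q * (real (1 + j * q) powr - 1))"
        by (intro sum_mono)
      also have "\<dots> \<le> real q * exp (2 * K)"
        unfolding sum_distrib_left[symmetric] by (intro mult_left_mono b) auto
      finally show ?thesis .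
    qed
    hence "summable (\<lambda>j. inverse (real (Suc j)))"
      by (intro summableI_nonneg_bounded) auto
    thus False using not_summable_harmonic[where 'a = real]
      by (subst (asm) summable_Suc_iff) simp
  qed
  then obtain J where J: "exp (2 * K) < (\<Sum>j<J. real (1 + j * q) powr - 1)" by blast
  have "((\<lambda>\<sigma>. \<Sum>j<J. real (1 + j * q) powr - \<sigma>) \<longlongrightarrow> (\<Sum>j<J. real (1 + j * q) powr - 1)) (at_right 1)"
  proof -
    have "1 + real j * real q \<noteq> 0" for j
      by (metis add_pos_nonneg less_numeral_extra(1,3) mult_nonneg_nonneg of_nat_0_le_iff)
    thus ?thesis by (intro tendsto_intros) auto
  qed
  from order_tendstoD(1)[OF this J]
  have "\<forall>\<^sub>F \<sigma> in at_right 1. exp (2 * K) < (\<Sum>j<J. real (1 + j * q) powr - \<sigma>)" .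
  moreover have "\<forall>\<^sub>F \<sigma> in at_right (1::real). \<sigma> > 1" by (simp add: eventually_at_right_less)
  ultimately show ?thesis
  proof eventually_elim
    case (elim \<sigma>)
    have "exp (2 * K) < exp (2 * (\<Sum>i. real (unramified_prime q i) powr - \<sigma>))"
      by (rule less_le_trans[OF elim(1) coprime_sum_le_exp[OF elim(2)]])
    thus ?case by simp
  qed
qed

end

section \<open>Steering a weighted sum of unit vectors\<close>

text \<open>Shifting the index by at most 4 in a decreasing sequence changes the sum over a residue class
  modulo 4 by at most one term, because the difference is dominated by a telescoping series.\<close>

lemma alternating_sums:
  fixes r :: "nat \<Rightarrow> real"
  assumes r: "decseq r" "summable r" and pos: "\<And>i. r i \<ge> 0" and kl: "k \<le> l" "l \<le> k + 4"
  obtains V where "(\<lambda>n. r (4 * n + k) - r (4 * n + l)) sums V" "0 \<le> V" "V \<le> r k"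
proof -
  have sub: "summable (\<lambda>n. r (4 * n + a))" for a
  proof -
    have "inj (\<lambda>n::nat. 4 * n + a)" by (auto simp: inj_def)
    from summable_reindex[OF r(2) this] pos show ?thesis by (simp add: o_def)
  qed
  have s: "(\<lambda>n. r (4 * n + k) - r (4 * n + l)) sums (\<Sum>n. r (4 * n + k) - r (4 * n + l))"
    by (intro summable_sums summable_diff sub)
  have "(\<lambda>n. r (4 * n + k)) \<longlonglongrightarrow> 0" by (rule summable_LIMSEQ_zero[OF sub])
  hence tele: "(\<lambda>n. r (4 * n + k) - r (4 * Suc n + k)) sums r k"
    using telescope_sums'[of "\<lambda>n. r (4 * n + k)" 0] by simp
  have "r (4 * n + k) - r (4 * n + l) \<le> r (4 * n + k) - r (4 * Suc n + k)" for n
    using decseqD[OF r(1), of "4 * n + l" "4 * Suc n + k"] kl(2) by simp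
  hence "(\<Sum>n. r (4 * n + k) - r (4 * n + l)) \<le> r k"
    by (rule sums_le[OF _ s tele])
  moreover have "r (4 * n + k) - r (4 * n + l) \<ge> 0" for n
    using decseqD[OF r(1), of "4 * n + k" "4 * n + l"] kl(1) by simp
  hence "0 \<le> (\<Sum>n. r (4 * n + k) - r (4 * n + l))"
    by (rule suminf_nonneg[OF sums_summable[OF s]])
  ultimately show ?thesis using that[OF s] by blast
qed

text \<open>For \<open>\<bar>c\<bar> \<le> 1\<close> this is the point of the upper unit semicircle above \<open>c\<close>; it depends continuously
  on \<open>c\<close> up to the end points.\<close>

definition arm :: "real \<Rightarrow> complex" where "arm c = Complex c (sqrt (1 - c\<^sup>2))"

lemma Re_arm [simp]: "Re (arm c) = c" by (simp add: arm_def)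

lemma norm_arm: "\<bar>c\<bar> \<le> 1 \<Longrightarrow> norm (arm c) = 1"
  using abs_square_le_1[of c] by (simp add: arm_def cmod_def)

lemma continuous_on_arm [continuous_intros]:
  "continuous_on A f \<Longrightarrow> continuous_on A (\<lambda>x. arm (f x))"
  unfolding arm_def Complex_eq by (intro continuous_intros)

text \<open>Within a block of four consecutive weights the first two receive \<open>a\<close> and its conjugate, and the other
  two receive \<open>\<i> b\<close> and \<open>\<i>\<close> times the conjugate of \<open>b\<close>. Were the weights within each
  pair equal, the first pair would contribute a real multiple of \<open>Re a\<close> and the second an imaginary
  multiple of \<open>Re b\<close>, so the two coordinates of the target could be set independently, with \<open>a\<close> and
  \<open>b\<close> continuous in the target. As the weights decrease, the imbalance of the pairs adds up to at
  most one weight in each direction, whence the error 2.\<close>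

lemma steering:
  fixes r :: "nat \<Rightarrow> real"
  assumes r: "decseq r" "summable r" and pos: "\<And>i. r i > 0" and r0: "r 0 \<le> 1"
    and R: "R > 0" "suminf r \<ge> 2 * R + 2"
  obtains \<eta> :: "complex \<Rightarrow> nat \<Rightarrow> complex"
  where "\<And>v i. v \<in> cball 0 R \<Longrightarrow> norm (\<eta> v i) = 1"
    and "\<And>i. continuous_on (cball 0 R) (\<lambda>v. \<eta> v i)"
    and "\<And>v. v \<in> cball 0 R \<Longrightarrow> norm ((\<Sum>i. \<eta> v i * r i) - v) \<le> 2"
proof -
  have pos': "r i \<ge> 0" for i using pos[of i] by simp
  have le1: "r i \<le> 1" for i using decseqD[OF r(1), of 0 i] r0 by simp
  have grp: "sum f {n * 4..<n * 4 + 4} = f (4 * n) + f (4 * n + 1) + f (4 * n + 2) + f (4 * n + 3)"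
    for f :: "nat \<Rightarrow> 'a::comm_monoid_add" and n :: nat
    by (simp add: eval_nat_numeral mult_ac add_ac)
  have sub: "summable (\<lambda>n. r (4 * n + a))" for a
  proof -
    have "inj (\<lambda>n::nat. 4 * n + a)" by (auto simp: inj_def)
    from summable_reindex[OF r(2) this] pos' show ?thesis by (simp add: o_def)
  qed
  define U where "U = (\<Sum>n. r (4 * n) + r (4 * n + 1))"
  define U' where "U' = (\<Sum>n. r (4 * n + 2) + r (4 * n + 3))"
  have U: "(\<lambda>n. r (4 * n) + r (4 * n + 1)) sums U"
    unfolding U_def using summable_add[OF sub[of 0] sub[of 1]] by (simp add: summable_sums)
  have U': "(\<lambda>n. r (4 * n + 2) + r (4 * n + 3)) sums U'"
    unfolding U'_def by (intro summable_sums summable_add sub)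
  obtain V where V: "(\<lambda>n. r (4 * n) - r (4 * n + 1)) sums V" "0 \<le> V" "V \<le> r 0"
    by (rule alternating_sums[OF r pos', of 0 1]) simp_all
  obtain V' where V': "(\<lambda>n. r (4 * n + 2) - r (4 * n + 3)) sums V'" "0 \<le> V'" "V' \<le> r 2"
    by (rule alternating_sums[OF r pos', of 2 3]) simp_all
  obtain D0 where D0: "(\<lambda>n. r (4 * n) - r (4 * n + 2)) sums D0" "0 \<le> D0" "D0 \<le> r 0"
    by (rule alternating_sums[OF r pos', of 0 2]) simp_all
  obtain D1 where D1: "(\<lambda>n. r (4 * n + 1) - r (4 * n + 3)) sums D1" "0 \<le> D1" "D1 \<le> r 1"
    by (rule alternating_sums[OF r pos', of 1 3]) simp_all
  \<comment> \<open>The two halves of the total weight differ by at most 2, so both are at least \<open>R\<close> and the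
      cosines \<open>Re v / U\<close> and \<open>Im v / U'\<close> below are admissible.\<close>
  have "U - U' = D0 + D1"
    using sums_unique2[OF sums_diff[OF U U'], of "D0 + D1"] sums_add[OF D0(1) D1(1)]
    by (simp add: algebra_simps)
  moreover have "U + U' = suminf r"
  proof -
    have "(\<lambda>n. sum r {n * 4..<n * 4 + 4}) sums suminf r"
      by (rule sums_group) (use r(2) in auto)
    thus ?thesis using sums_unique2 sums_add[OF U U'] unfolding grp by (simp add: add.assoc) blast
  qed
  ultimately have UR: "U \<ge> R" "U' \<ge> R" using R D0 D1 le1[of 0] le1[of 1] by linarith+
  define \<eta> :: "complex \<Rightarrow> nat \<Rightarrow> complex" where
    "\<eta> v i = (if i mod 4 = 0 then arm (Re v / U) else if i mod 4 = 1 then cnj (arm (Re v / U))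
       else if i mod 4 = 2 then \<i> * arm (Im v / U') else \<i> * cnj (arm (Im v / U')))" for v i
  have c1: "\<bar>Re v / U\<bar> \<le> 1" and c2: "\<bar>Im v / U'\<bar> \<le> 1" if "v \<in> cball 0 R" for v
    using that UR R(1) abs_Re_le_cmod[of v] abs_Im_le_cmod[of v] by (auto simp: abs_divide)
  have norm: "norm (\<eta> v i) = 1" if "v \<in> cball 0 R" for v i
    using norm_arm[OF c1[OF that]] norm_arm[OF c2[OF that]] by (simp add: \<eta>_def norm_mult)
  have cont: "continuous_on (cball 0 R) (\<lambda>v. \<eta> v i)" for i
  proof -
    have A: "continuous_on (cball 0 R) (\<lambda>v. arm (Re v / U))"
      and B: "continuous_on (cball 0 R) (\<lambda>v. arm (Im v / U'))"
      using UR R(1) by (auto intro!: continuous_intros)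
    show ?thesis
      by (cases "i mod 4 = 0"; cases "i mod 4 = 1"; cases "i mod 4 = 2")
        (simp_all add: \<eta>_def A B continuous_on_cnj continuous_on_mult)
  qed
  have dist: "norm ((\<Sum>i. \<eta> v i * r i) - v) \<le> 2" if v: "v \<in> cball 0 R" for v
  proof -
    define a where "a = arm (Re v / U)"
    define b where "b = arm (Im v / U')"
    have a: "Re a * U = Re v" "\<bar>Im a\<bar> \<le> 1" and b: "Re b * U' = Im v" "\<bar>Im b\<bar> \<le> 1"
      using UR R(1) norm_arm[OF c1[OF v]] norm_arm[OF c2[OF v]] abs_Im_le_cmod[of a] abs_Im_le_cmod[of b]
      by (auto simp: a_def b_def)
    have e: "\<eta> v (4 * n) = a" "\<eta> v (4 * n + 1) = cnj a" "\<eta> v (4 * n + 2) = \<i> * b" "\<eta> v (4 * n + 3) = \<i> * cnj b" for n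
    proof -
      have "(4 * n) mod 4 = 0" "(4 * n + 1) mod 4 = 1" "(4 * n + 2) mod 4 = 2" "(4 * n + 3) mod 4 = 3"
        by presburger+
      thus "\<eta> v (4 * n) = a" "\<eta> v (4 * n + 1) = cnj a" "\<eta> v (4 * n + 2) = \<i> * b" "\<eta> v (4 * n + 3) = \<i> * cnj b"
        by (simp_all only: \<eta>_def a_def b_def) simp_all
    qed
    have "summable (\<lambda>i. \<eta> v i * r i)"
      by (rule summable_comparison_test[OF _ r(2)]) (use norm[OF v] pos' in \<open>auto simp: norm_mult\<close>)
    hence "(\<lambda>n. \<Sum>i\<in>{n * 4..<n * 4 + 4}. \<eta> v i * r i) sums (\<Sum>i. \<eta> v i * r i)"
      by (intro sums_group summable_sums) auto
    moreover have "(\<Sum>i\<in>{n * 4..<n * 4 + 4}. \<eta> v i * r i) =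
        of_real (Re a) * of_real (r (4 * n) + r (4 * n + 1)) + \<i> * of_real (Im a) * of_real (r (4 * n) - r (4 * n + 1))
        + \<i> * of_real (Re b) * of_real (r (4 * n + 2) + r (4 * n + 3)) - of_real (Im b) * of_real (r (4 * n + 2) - r (4 * n + 3))" for n
      unfolding grp e by (simp add: complex_eq_iff algebra_simps)
    ultimately have "(\<lambda>n. of_real (Re a) * of_real (r (4 * n) + r (4 * n + 1)) + \<i> * of_real (Im a) * of_real (r (4 * n) - r (4 * n + 1))
        + \<i> * of_real (Re b) * of_real (r (4 * n + 2) + r (4 * n + 3)) - of_real (Im b) * of_real (r (4 * n + 2) - r (4 * n + 3)))
        sums (\<Sum>i. \<eta> v i * r i)" by simp
    moreover have "(\<lambda>n. of_real (Re a) * of_real (r (4 * n) + r (4 * n + 1)) + \<i> * of_real (Im a) * of_real (r (4 * n) - r (4 * n + 1))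
        + \<i> * of_real (Re b) * of_real (r (4 * n + 2) + r (4 * n + 3)) - of_real (Im b) * of_real (r (4 * n + 2) - r (4 * n + 3)))
        sums (of_real (Re a) * of_real U + \<i> * of_real (Im a) * of_real V + \<i> * of_real (Re b) * of_real U' - of_real (Im b) * of_real V' :: complex)"
      by (intro sums_add sums_diff sums_mult sums_of_real U U' V V')
    ultimately have "(\<Sum>i. \<eta> v i * r i) = of_real (Re a) * of_real U + \<i> * of_real (Im a) * of_real V + \<i> * of_real (Re b) * of_real U' - of_real (Im b) * of_real V'"
      by (rule sums_unique2)
    also have "\<dots> = v + (\<i> * of_real (Im a * V) - of_real (Im b * V'))"
      using a(1) b(1) by (simp add: complex_eq_iff)
    finally have "norm ((\<Sum>i. \<eta> v i * r i) - v) = norm (\<i> * of_real (Im a * V) - of_real (Im b * V'))" by simp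
    also have "\<dots> \<le> norm (\<i> * of_real (Im a * V)) + norm (complex_of_real (Im b * V'))" by (rule norm_triangle_ineq4)
    also have "\<dots> = \<bar>Im a\<bar> * V + \<bar>Im b\<bar> * V'" using V V' by (simp add: norm_mult abs_mult)
    also have "\<dots> \<le> 1 * 1 + 1 * 1"
      using V V' a b le1[of 0] le1[of 2] by (intro add_mono mult_mono) auto
    finally show ?thesis by simp
  qed
  show ?thesis by (rule that[OF norm cont dist])
qed

section \<open>A twist with a zero near the line of absolute convergence\<close>

lemma norm_minus_Ln_minus_le:
  assumes "norm (x :: complex) < 1 / 2"
  shows "norm (- Ln (1 - x) - x) \<le> 2 * (norm x)\<^sup>2"
proof -
  have "norm (- Ln (1 - x) - x) = norm (Ln (1 + - x) - - x)"
    by (metis norm_minus_commute uminus_add_conv_diff add.commute)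
  also have "\<dots> \<le> (norm (- x))\<^sup>2 / (1 - norm (- x))"
    by (rule Ln_approx_linear) (use assms in simp)
  also have "\<dots> \<le> (norm x)\<^sup>2 / (1 / 2)"
    unfolding norm_minus_cancel using assms by (intro divide_left_mono) auto
  finally show ?thesis by simp
qed

lemma twisted_L_eq_exp:
  assumes chi: "dirichlet_character q chi" "q \<ge> 1" and \<sigma>: "\<sigma> > 1"
    and w: "\<And>p. norm (w p) = 1"
    and \<eta>: "\<And>i. chi (int (unramified_prime q i)) * w (unramified_prime q i) = \<eta> i" "\<And>i. norm (\<eta> i) = 1"
  shows "twisted_L chi (twist w) 1 (of_real \<sigma>)
       = exp (\<Sum>i. - Ln (1 - \<eta> i * of_real (real (unramified_prime q i) powr - \<sigma>)))"
proof -
  define p where "p = unramified_prime q"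
  define f where "f n = chi (int n) * (twist w n * of_nat n powr (- of_real \<sigma>))" for n
  note r = unramified_prime_powr[OF chi(2) \<sigma>]
  have fp: "f (p i) = \<eta> i * of_real (real (p i) powr - \<sigma>)" for i
  proof -
    have "complex_of_nat (p i) powr (- of_real \<sigma>) = of_real (real (p i) powr - \<sigma>)"
      using powr_of_real[of "real (p i)" "- \<sigma>"] by simp
    moreover have "twist w (p i) = w (p i)"
      unfolding p_def by (rule twist_prime[OF unramified_prime(1)[OF chi(2)]])
    ultimately show ?thesis using \<eta>(1)[of i] by (simp add: f_def p_def mult.assoc[symmetric])
  qed
  have bound: "norm (f (Suc n)) \<le> real (Suc n) powr - \<sigma>" for n
    using norm_twisted_L_term[of chi n "twist w" \<sigma> 1 "of_real \<sigma>"]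
    by (simp add: f_def character_norm_le[OF chi] norm_twist w)
  have summ: "summable (\<lambda>n. norm (f n))"
  proof -
    have "summable (\<lambda>n. norm (f (Suc n)))"
      by (rule summable_comparison_test[OF _ summable_Suc_powr[OF \<sigma>]]) (use bound in auto)
    thus ?thesis by (subst (asm) summable_Suc_iff)
  qed
  have "suminf f = exp (\<Sum>i. - Ln (1 - f (p i)))"
  proof (rule euler_product_exp)
    show "f (m * n) = f m * f n" for m n
    proof (cases "m = 0 \<or> n = 0")
      case False
      thus ?thesis by (simp add: f_def character_mult[OF chi(1)] twist_mult powr_times_real)
    qed (auto simp: f_def)
    show "f 0 = 0" by (simp add: f_def)
    show "f 1 = 1" by (simp add: f_def character_1[OF chi(1)])
    show "prime (p i)" for i unfolding p_def by (rule unramified_prime(1)[OF chi(2)])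
    show "strict_mono p" unfolding p_def by (rule strict_mono_unramified_prime[OF chi(2)])
    show "f s = 0" if s: "prime s" "s \<notin> range p" for s
    proof -
      have "s dvd q" using s by (simp add: p_def range_unramified_prime[OF chi(2)])
      hence "\<not> coprime s q" using s(1) by (meson coprime_absorb_left not_prime_unit)
      hence "chi (int s) = 0" using character_nonzero_iff[OF chi(1), of "int s"] by simp
      thus ?thesis by (simp add: f_def)
    qed
    show "norm (f (p i)) < 1 / 2" for i
      unfolding fp norm_mult \<eta>(2) using r(2)[of i] by (simp add: p_def)
  qed (rule summ)
  moreover have "suminf f = twisted_L chi (twist w) 1 (of_real \<sigma>)"
  proof -
    have "f 0 = 0" by (simp add: f_def)
    hence "suminf f = (\<Sum>n. f (Suc n))"
      using suminf_split_head[OF summable_norm_cancel[OF summ]] by simp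
    thus ?thesis by (simp add: twisted_L_def f_def)
  qed
  ultimately show ?thesis unfolding p_def[symmetric] by (simp add: fp)
qed

text \<open>The fixed point argument. The disc \<open>K\<close> contains all values of \<open>G\<close>, and \<open>C\<close> bounds \<open>Ln\<close> on it. As \<open>C\<close>
  depends on \<open>N\<close> alone, the radius \<open>R\<close> of the disc of targets can be fixed before \<open>\<sigma>\<close>
  is moved close enough to 1 for the weights to reach all of that disc.\<close>

lemma exists_twisted_zero:
  assumes chi: "dirichlet_character q chi" "q \<ge> 1" and N: "N \<ge> 2" and "b > 1"
  obtains \<sigma> w where "1 < \<sigma>" "\<sigma> < b" "\<And>p. norm (w p) = 1"
    "(\<Sum>k=1..N. twisted_L chi (twist w) k (of_real \<sigma>)) = 0"
proof -
  note chi_le = character_norm_le[OF chi]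
  define M where "M = real N - 1"
  define K where "K = cball (complex_of_real M) (71 / 100 * M)"
  have M: "M \<ge> 1" using N by (simp add: M_def)
  have ReK: "Re z > 0" if "z \<in> K" for z
  proof -
    have "M - Re z \<le> 71 / 100 * M"
      using that complex_Re_le_cmod[of "of_real M - z"] by (simp add: K_def dist_norm)
    thus ?thesis using M by simp
  qed
  have LnK: "continuous_on K Ln"
    by (rule continuous_on_Ln) (use ReK in \<open>fastforce simp: complex_nonpos_Reals_iff\<close>)
  have "compact (Ln ` K)" by (rule compact_continuous_image[OF LnK]) (simp add: K_def)
  then obtain C where C: "C > 0" "\<And>z. z \<in> K \<Longrightarrow> norm (Ln z) \<le> C"
    using compact_imp_bounded bounded_pos by (metis imageI)
  \<comment> \<open>The summand 10 absorbs the error 2 of steering, the quadratic error 4 of the logarithms and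
      \<open>pi < 4\<close>.\<close>
  define R where "R = C + 10"
  have R: "R > 0" using C by (simp add: R_def)
  define p where "p = unramified_prime q"
  have "\<forall>\<^sub>F \<sigma> in at_right 1. 1 < \<sigma> \<and> \<sigma> < b \<and> 2 * R + 2 \<le> (\<Sum>i. real (p i) powr - \<sigma>)"
    unfolding p_def
    by (intro eventually_conj prime_sum_large[OF chi(2)] eventually_at_right_less eventually_at_right_real[OF \<open>b > 1\<close>, THEN eventually_mono]) auto
  then obtain \<sigma> where \<sigma>: "\<sigma> > 1" "\<sigma> < b" "2 * R + 2 \<le> (\<Sum>i. real (p i) powr - \<sigma>)"
    using eventually_happens[of _ "at_right (1::real)"] by (auto simp: trivial_limit_at_right_real)
  define r where "r i = real (p i) powr - \<sigma>" for i
  note rr = unramified_prime_powr[OF chi(2) \<sigma>(1), folded p_def, folded r_def]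
  have r_pos: "r i \<ge> 0" for i using rr(1)[of i] by simp
  have r0: "r 0 \<le> 1" using rr(2)[of 0] by simp
  have r: "decseq r" "summable r" using rr(4,5) by (simp_all add: r_def[abs_def])
  have P: "suminf r \<ge> 2 * R + 2" using \<sigma>(3) by (simp add: r_def[abs_def])
  obtain \<eta> :: "complex \<Rightarrow> nat \<Rightarrow> complex" where \<eta>: "\<And>v i. v \<in> cball 0 R \<Longrightarrow> norm (\<eta> v i) = 1"
    "\<And>i. continuous_on (cball 0 R) (\<lambda>v. \<eta> v i)"
    "\<And>v. v \<in> cball 0 R \<Longrightarrow> norm ((\<Sum>i. \<eta> v i * r i) - v) \<le> 2"
    by (fact steering[OF r rr(1) r0 R P])
  \<comment> \<open>Dividing by \<open>chi\<close> makes \<open>\<eta>\<close> the value of the twisted character; the value 1 is a harmless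
      choice at the primes where \<open>chi\<close> vanishes.\<close>
  define w where "w v s = (if s \<in> range p then \<eta> v (inv_into UNIV p s) / chi (int s) else 1)" for v s
  have chi_p: "norm (chi (int (p i))) = 1" for i
    using unramified_prime(2)[OF chi(2), of i] by (intro character_unimodular[OF chi]) (simp add: p_def)
  have chi_nz: "chi (int (p i)) \<noteq> 0" for i using chi_p[of i] by auto
  have w_norm: "norm (w v s) = 1" if "v \<in> cball 0 R" for v s
    using \<eta>(1)[OF that] chi_p chi_nz by (auto simp: w_def norm_divide)
  have inj_p: "inj p"
    unfolding p_def by (rule strict_mono_imp_inj_on[OF strict_mono_unramified_prime[OF chi(2)]])
  have w_p: "chi (int (p i)) * w v (p i) = \<eta> v i" for v i
    using inj_p chi_nz[of i] by (simp add: w_def)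
  have w_cont: "continuous_on (cball 0 R) (\<lambda>v. w v s)" for s
  proof (cases "s \<in> range p")
    case True
    then obtain i where i: "s = p i" by blast
    show ?thesis unfolding w_def i using inj_p \<eta>(2)[of i] chi_nz[of i] by (simp add: continuous_on_divide)
  qed (simp add: w_def)
  define G where "G v = (\<Sum>k=2..N. twisted_L chi (twist (w v)) k (of_real \<sigma>))" for v
  have G_cont: "continuous_on (cball 0 R) G"
    unfolding G_def using \<sigma>(1)
    by (intro continuous_on_sum twisted_L_continuous_on chi_le w_norm w_cont) auto
  have GK: "G v \<in> K" if v: "v \<in> cball 0 R" for v
  proof -
    have le1: "norm (twist (w v) n) \<le> 1" for n using norm_twist[OF w_norm[OF v]] by simp
    have "G v - of_real M = (\<Sum>k=2..N. twisted_L chi (twist (w v)) k (of_real \<sigma>) - 1)"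
      using N by (simp add: G_def sum_subtractf M_def)
    also have "norm \<dots> \<le> (\<Sum>k=2..N. 71 / 100)"
    proof (rule sum_norm_le)
      fix k assume k: "k \<in> {2..N}"
      have "real k * Re (of_real \<sigma>) \<ge> 2 * 1" using k \<sigma>(1) by (intro mult_mono) auto
      thus "norm (twisted_L chi (twist (w v)) k (of_real \<sigma>) - 1) \<le> 71 / 100"
        by (intro twisted_L_near_1 chi_le le1 character_1[OF chi(1)] twist_1) simp
    qed
    also have "\<dots> = 71 / 100 * M" using N by (simp add: M_def)
    finally show ?thesis by (simp add: K_def dist_norm norm_minus_commute)
  qed
  define \<Lambda> where "\<Lambda> v = (\<Sum>i. - Ln (1 - \<eta> v i * r i))" for v
  have x_small: "norm (\<eta> v i * r i) = r i" "norm (\<eta> v i * r i) < 1 / 2" if "v \<in> cball 0 R" for v i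
    using \<eta>(1)[OF that] rr(2)[of i] r_pos[of i] by (auto simp: norm_mult)
  have L_bound: "norm (- Ln (1 - \<eta> v i * r i)) \<le> 2 * r i" if "v \<in> cball 0 R" for v i
    using norm_Ln_le[of "- (\<eta> v i * r i)"] x_small[OF that, of i] by simp
  have \<Lambda>_cont: "continuous_on (cball 0 R) \<Lambda>"
    unfolding \<Lambda>_def
  proof (rule continuous_on_suminf[OF _ L_bound summable_mult[OF r(2)]])
    fix i
    have "1 - \<eta> v i * r i \<notin> \<real>\<^sub>\<le>\<^sub>0" if "v \<in> cball 0 R" for v
      using x_small(2)[OF that, of i] complex_Re_le_cmod[of "\<eta> v i * r i"]
      by (auto simp: complex_nonpos_Reals_iff)
    thus "continuous_on (cball 0 R) (\<lambda>v. - Ln (1 - \<eta> v i * r i))"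
      by (intro continuous_intros \<eta>(2)) auto
  qed
  have \<Lambda>_near: "norm (\<Lambda> v - v) \<le> 6" if v: "v \<in> cball 0 R" for v
  proof -
    have s1: "summable (\<lambda>i. - Ln (1 - \<eta> v i * r i))"
      by (rule summable_comparison_test[OF _ summable_mult[OF r(2), of 2]]) (use L_bound[OF v] in auto)
    have s2: "summable (\<lambda>i. \<eta> v i * r i)"
      by (rule summable_comparison_test[OF _ r(2)]) (use x_small(1)[OF v] in auto)
    have sq: "(\<lambda>n. 2 * (1 / real ((n + 1)\<^sup>2))) sums (2 * (pi\<^sup>2 / 6))"
      using sums_mult[OF inverse_squares_sums, of 2] by simp
    have "\<Lambda> v - (\<Sum>i. \<eta> v i * r i) = (\<Sum>i. - Ln (1 - \<eta> v i * r i) - \<eta> v i * r i)"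
      unfolding \<Lambda>_def by (rule suminf_diff[OF s1 s2])
    also have "norm \<dots> \<le> (\<Sum>n. 2 * (1 / real ((n + 1)\<^sup>2)))"
    proof (rule norm_suminf_le[OF _ sums_summable[OF sq]])
      fix i
      have "norm (- Ln (1 - \<eta> v i * r i) - \<eta> v i * r i) \<le> 2 * (r i)\<^sup>2"
        using norm_minus_Ln_minus_le[OF x_small(2)[OF v, of i]] x_small(1)[OF v, of i] by simp
      also have "r i \<le> real (Suc i) powr - 1"
        by (rule order.trans[OF rr(3) powr_mono]) (use \<sigma>(1) in auto)
      hence "r i \<le> 1 / real (i + 1)" by (simp add: powr_minus_divide)
      hence "(r i)\<^sup>2 \<le> (1 / real (i + 1))\<^sup>2" by (intro power_mono r_pos)
      hence "2 * (r i)\<^sup>2 \<le> 2 * (1 / real ((i + 1)\<^sup>2))" by (simp add: power_divide)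
      finally show "norm (- Ln (1 - \<eta> v i * r i) - \<eta> v i * r i) \<le> 2 * (1 / real ((i + 1)\<^sup>2))" .
    qed
    also have "\<dots> = 2 * (pi\<^sup>2 / 6)" using sq by (simp add: sums_iff)
    also have "\<dots> \<le> 4"
    proof -
      have "pi\<^sup>2 \<le> (16 / 5)\<^sup>2" using pi_approx by (intro power_mono) auto
      thus ?thesis by (simp add: power2_eq_square)
    qed
    finally have "norm (\<Lambda> v - (\<Sum>i. \<eta> v i * r i)) \<le> 4" .
    thus ?thesis
      using \<eta>(3)[OF v] norm_triangle_ineq[of "\<Lambda> v - (\<Sum>i. \<eta> v i * r i)" "(\<Sum>i. \<eta> v i * r i) - v"] by simp
  qed
  define T where "T v = v - \<Lambda> v + \<i> * pi + Ln (G v)" for v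
  have T_cont: "continuous_on (cball 0 R) T"
    unfolding T_def
    by (intro continuous_intros \<Lambda>_cont continuous_on_compose2[OF LnK G_cont]) (use GK in auto)
  have T_into: "T v \<in> cball 0 R" if v: "v \<in> cball 0 R" for v
  proof -
    have "norm (T v) \<le> norm (v - \<Lambda> v) + norm (\<i> * complex_of_real pi) + norm (Ln (G v))"
      unfolding T_def by (intro order.trans[OF norm_triangle_ineq] add_mono norm_triangle_ineq order.refl)
    also have "\<dots> \<le> 6 + 4 + C"
      using \<Lambda>_near[OF v] C(2)[OF GK[OF v]] pi_less_4 by (intro add_mono) (auto simp: norm_minus_commute norm_mult)
    finally show ?thesis by (simp add: R_def)
  qed
  obtain v where v: "v \<in> cball 0 R" "T v = v"
    by (rule brouwer[OF compact_cball convex_cball _ T_cont]) (use R T_into in auto)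
  hence "\<Lambda> v = \<i> * pi + Ln (G v)" unfolding T_def by (simp add: algebra_simps)
  moreover have "G v \<noteq> 0" using ReK[OF GK[OF v(1)]] by auto
  ultimately have "exp (\<Lambda> v) = - G v" by (simp add: exp_add)
  moreover have "twisted_L chi (twist (w v)) 1 (of_real \<sigma>) = exp (\<Lambda> v)"
    unfolding \<Lambda>_def r_def p_def
    by (rule twisted_L_eq_exp[OF chi \<sigma>(1) w_norm[OF v(1)] _ \<eta>(1)[OF v(1)]]) (use w_p in \<open>simp add: p_def\<close>)
  moreover have "(\<Sum>k=1..N. twisted_L chi (twist (w v)) k (of_real \<sigma>))
      = twisted_L chi (twist (w v)) 1 (of_real \<sigma>) + G v"
    unfolding G_def using N by (subst sum.atLeast_Suc_atMost) (auto simp: numeral_2_eq_2)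
  ultimately have "(\<Sum>k=1..N. twisted_L chi (twist (w v)) k (of_real \<sigma>)) = 0" by simp
  with \<sigma>(1,2) w_norm[OF v(1)] show ?thesis by (rule that)
qed

section \<open>Infinitely many zeros\<close>

lemma uniform_limit_sum:
  fixes f :: "'i \<Rightarrow> 'n \<Rightarrow> 'a \<Rightarrow> 'b :: real_normed_vector"
  assumes "\<And>i. i \<in> I \<Longrightarrow> uniform_limit X (f i) (l i) F"
  shows "uniform_limit X (\<lambda>n x. \<Sum>i\<in>I. f i n x) (\<lambda>x. \<Sum>i\<in>I. l i x) F"
  using assms by (induction I rule: infinite_finite_induct) (auto intro!: uniform_limit_add uniform_limit_const)

theorem mainTheorem2:
  fixes N q :: nat and chi :: "int \<Rightarrow> complex"
  assumes "N \<ge> 2" and "q \<ge> 1" and "dirichlet_character q chi"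
  shows "infinite {s :: complex. Re s > 1 \<and> (\<Sum>k=1..N. dirichlet_L chi (of_nat k * s)) = 0}"
proof
  note N = assms(1) and chi = assms(3,2)
  note chi_le = character_norm_le[OF chi]
  define Z where "Z = {s :: complex. Re s > 1 \<and> (\<Sum>k=1..N. dirichlet_L chi (of_nat k * s)) = 0}"
  assume "finite {s :: complex. Re s > 1 \<and> (\<Sum>k=1..N. dirichlet_L chi (of_nat k * s)) = 0}"
  hence finZ: "finite Z" by (simp add: Z_def)
  \<comment> \<open>Inserting 2 makes the minimum meaningful when there are no zeros at all.\<close>
  define b where "b = Min (insert 2 (Re ` Z))"
  have b: "b > 1" using finZ by (auto simp: b_def Z_def)
  have no_zero: "s \<notin> Z" if "Re s < b" for s
    using that finZ by (auto simp: b_def)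
  obtain \<sigma> w where \<sigma>: "1 < \<sigma>" "\<sigma> < b" and w: "\<And>p. norm (w p) = 1"
    and zero: "(\<Sum>k=1..N. twisted_L chi (twist w) k (of_real \<sigma>)) = 0"
    by (fact exists_twisted_zero[OF chi N b])
  have u: "norm (twist w n) \<le> 1" for n using norm_twist[OF w] by simp
  obtain t where t: "\<And>n. n > 0 \<Longrightarrow> (\<lambda>m. of_nat n powr (- (\<i> * of_real (t m)))) \<longlonglongrightarrow> twist w n"
    by (fact kronecker_primes[OF w])
  have v: "norm (complex_of_nat n powr (- (\<i> * of_real x))) \<le> 1" for n x
    by (cases "n = 0") (simp_all add: norm_powr_real_powr)
  define g where "g s = (\<Sum>k=1..N. twisted_L chi (twist w) k s)" for s
  define F where "F m s = (\<Sum>k=1..N. twisted_L chi (\<lambda>n. of_nat n powr (- (\<i> * of_real (t m)))) k s)" for m :: nat and s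
  define S where "S = {s. 1 < Re s} \<inter> {s. Re s < b}"
  have holg: "g holomorphic_on {s. Re s > 1}"
    unfolding g_def by (intro holomorphic_on_sum twisted_L_holomorphic chi_le u) auto
  have nonconst: "\<not> g constant_on S"
  proof
    assume "g constant_on S"
    then obtain c where c: "\<And>z. z \<in> S \<Longrightarrow> g z = c" by (auto simp: constant_on_def)
    have "c = 0" using c[of "of_real \<sigma>"] \<sigma> zero by (simp add: S_def g_def)
    hence g0: "g z = 0" if "z \<in> S" for z using c[OF that] by simp
    \<comment> \<open>A constant limit would vanish on the whole half-plane, but at 2 each of the \<open>N\<close> series is
        within 71 / 100 of 1.\<close>
    have "g 2 = 0"
    proof (rule analytic_continuation[OF holg])
      show "open {s. Re s > 1}" by (rule open_halfspace_Re_gt)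
      show "connected {s. Re s > 1}" by (rule convex_connected[OF convex_halfspace_Re_gt])
      show "S \<subseteq> {s. Re s > 1}" by (auto simp: S_def)
      have "open S" unfolding S_def by (intro open_Int open_halfspace_Re_gt open_halfspace_Re_lt)
      moreover have "of_real \<sigma> \<in> S" using \<sigma> by (simp add: S_def)
      ultimately show "of_real \<sigma> islimpt S" by (simp add: interior_limit_point interior_open)
      show "complex_of_real \<sigma> \<in> {s. Re s > 1}" "2 \<in> {s. Re s > 1}" using \<sigma> by auto
    qed (rule g0)
    moreover have "norm (g 2 - of_nat N) \<le> 71 / 100 * real N"
    proof -
      have "g 2 - of_nat N = (\<Sum>k=1..N. twisted_L chi (twist w) k 2 - 1)"
        by (simp add: g_def sum_subtractf)
      also have "norm \<dots> \<le> (\<Sum>k=1..N. 71 / 100)"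
        by (intro sum_norm_le twisted_L_near_1 chi_le u character_1[OF chi(1)] twist_1) auto
      finally show ?thesis by simp
    qed
    ultimately show False using N by simp
  qed
  have "g (of_real \<sigma>) \<noteq> 0"
  proof (rule Hurwitz_no_zeros[of S F g])
    show "open S" unfolding S_def by (intro open_Int open_halfspace_Re_gt open_halfspace_Re_lt)
    show "connected S"
      unfolding S_def by (intro convex_connected convex_Int convex_halfspace_Re_gt convex_halfspace_Re_lt)
    show "F m holomorphic_on S" for m
      unfolding F_def
      by (intro holomorphic_on_sum holomorphic_on_subset[OF twisted_L_holomorphic] chi_le v) (auto simp: S_def)
    show "g holomorphic_on S" by (rule holomorphic_on_subset[OF holg]) (auto simp: S_def)
    show "\<not> g constant_on S" by (rule nonconst)
    show "F m z \<noteq> 0" if "z \<in> S" for m z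
    proof -
      have "F m z = (\<Sum>k=1..N. dirichlet_L chi (of_nat k * (z + \<i> * of_real (t m))))"
        by (simp add: F_def twisted_L_shift)
      thus ?thesis using that no_zero[of "z + \<i> * of_real (t m)"] by (auto simp: S_def Z_def)
    qed
    show "of_real \<sigma> \<in> S" using \<sigma> by (simp add: S_def)
    show "uniform_limit K F g sequentially" if K: "compact K" "K \<subseteq> S" for K
    proof (cases "K = {}")
      case False
      obtain z where z: "z \<in> K" "\<And>y. y \<in> K \<Longrightarrow> Re z \<le> Re y"
        using continuous_attains_inf[OF K(1) False, of Re] continuous_on_Re[OF continuous_on_id] by auto
      have "Re z > 1" using z(1) K(2) by (auto simp: S_def)
      have "uniform_limit {s. Re s \<ge> Re z} F g sequentially"
        unfolding F_def g_def
        by (intro uniform_limit_sum twisted_L_uniform_limit chi_le u v t \<open>Re z > 1\<close>) auto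
      thus ?thesis by (rule uniform_limit_on_subset) (use z(2) in auto)
    qed auto
  qed
  thus False using zero by (simp add: g_def)
qed

end
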